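(* Let $n\ge 2$ be an integer. The metric dimension of $\Delta(SD_{8n})$ is \[\dim(\Delta(SD_{8n}))=\begin{cases}6n-2 & \text{if } n \text{ is even},\\ 7n-2 & \text{if } n\text{ is odd}.\end{cases}\]
   Context: For an integer $n\ge 2$, the semidihedral group is $SD_{8n}=\langle a,b : a^{4n}=b^2=e,\ ba=a^{2n-1}b\rangle$, a group of order $8n$. The commuting graph $\Delta(G)$ of a group $G$ is the simple graph with vertex set $G$ in which two distinct vertices $x,y$ are adjacent iff $xy=yx$. A vertex $z$ of a connected graph $\Gamma$ resolves vertices $u,v$ if $d(z,u)\ne d(z,v)$, where $d$ is the graph distance. A set $U$ of vertices is a resolving set if every pair of distinct vertices is resolved by some vertex of $U$. The metric dimension $\dim(\Gamma)$ is the least cardinality of a resolving set. *)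

theory Defs
  imports "HOL-Algebra.Group" "Graph_Theory.Graph_Theory"
begin

section \<open>Groups given by generators and relations\<close>

text \<open>
  Words in the letters \<open>x\<close> and \<open>x\<^sup>-\<^sup>1\<close> for generators \<open>x\<close>: \<open>(x, True)\<close> encodes \<open>x\<close> and
  \<open>(x, False)\<close> its formal inverse. A relation \<open>l = r\<close> is the pair \<open>(l, r)\<close>.
\<close>

type_synonym 'g gword = "('g \<times> bool) list"

inductive pres_eq :: "('g gword \<times> 'g gword) set \<Rightarrow> 'g gword \<Rightarrow> 'g gword \<Rightarrow> bool"
  for R :: "('g gword \<times> 'g gword) set" where
  refl: "pres_eq R w w"
| sym: "pres_eq R v w \<Longrightarrow> pres_eq R w v"
| trans: "pres_eq R u v \<Longrightarrow> pres_eq R v w \<Longrightarrow> pres_eq R u w"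
| cancel: "pres_eq R (u @ [(x, s), (x, \<not> s)] @ v) (u @ v)"
| rel: "(l, r) \<in> R \<Longrightarrow> pres_eq R (u @ l @ v) (u @ r @ v)"

definition pres_rel :: "('g gword \<times> 'g gword) set \<Rightarrow> ('g gword \<times> 'g gword) set" where
  "pres_rel R = {(v, w). pres_eq R v w}"

definition presented_group :: "('g gword \<times> 'g gword) set \<Rightarrow> 'g gword set monoid" where
  "presented_group R =
     \<lparr> carrier = UNIV // pres_rel R,
       monoid.mult = (\<lambda>A B. \<Union>v\<in>A. \<Union>w\<in>B. pres_rel R `` {v @ w}),
       monoid.one = pres_rel R `` {[]} \<rparr>"

lemma equiv_pres_rel: "equiv UNIV (pres_rel R)"
proof (rule equivI)
  show "refl (pres_rel R)"
    by (simp add: refl_on_def pres_rel_def pres_eq.refl)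
  show "sym (pres_rel R)"
    by (auto simp: sym_def pres_rel_def intro: pres_eq.sym)
  show "trans (pres_rel R)"
    by (auto simp: trans_def pres_rel_def intro: pres_eq.trans)
qed simp

lemma pres_class_eq: "pres_rel R `` {v} = pres_rel R `` {w} \<longleftrightarrow> pres_eq R v w"
  using eq_equiv_class_iff[OF equiv_pres_rel, of v w R] by (simp add: pres_rel_def)

lemma pres_eq_context: "pres_eq R v w \<Longrightarrow> pres_eq R (p @ v @ q) (p @ w @ q)"
proof (induction rule: pres_eq.induct)
  case (cancel u x s v)
  show ?case using pres_eq.cancel[of R "p @ u" x s "v @ q"] by simp
next
  case (rel l r u v)
  then show ?case using pres_eq.rel[of l r R "p @ u" "v @ q"] by simp
qed (auto intro: pres_eq.intros)

lemma pres_eq_append: "pres_eq R v v' \<Longrightarrow> pres_eq R w w' \<Longrightarrow> pres_eq R (v @ w) (v' @ w')"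
  using pres_eq_context[of R v v' "[]" w] pres_eq_context[of R w w' v' "[]"]
  by (auto intro: pres_eq.trans)

lemma pres_mult:
  "(pres_rel R `` {v}) \<otimes>\<^bsub>presented_group R\<^esub> (pres_rel R `` {w}) = pres_rel R `` {v @ w}"
proof -
  have "congruent2 (pres_rel R) (pres_rel R) (\<lambda>v w. pres_rel R `` {v @ w})"
    unfolding congruent2_def pres_class_eq by (auto simp: pres_rel_def pres_eq_append)
  then show ?thesis
    by (simp add: presented_group_def UN_equiv_class2[OF equiv_pres_rel equiv_pres_rel])
qed

lemma pres_eq_inverse: "pres_eq R (rev (map (\<lambda>(x, s). (x, \<not> s)) w) @ w) []"
proof (induction w)
  case (Cons c w)
  obtain x s where c: "c = (x, s)" by force
  let ?w = "rev (map (\<lambda>(x, s). (x, \<not> s)) w)"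
  have "pres_eq R (?w @ [(x, \<not> s), (x, \<not> \<not> s)] @ w) (?w @ w)"
    by (rule pres_eq.cancel)
  then show ?case using Cons c by (auto intro: pres_eq.trans)
qed (simp add: pres_eq.refl)

lemma group_presented_group: "group (presented_group R)"
proof (rule groupI)
  fix A assume "A \<in> carrier (presented_group R)"
  then obtain w where A: "A = pres_rel R `` {w}"
    by (auto simp: presented_group_def elim: quotientE)
  show "\<exists>B\<in>carrier (presented_group R). B \<otimes>\<^bsub>presented_group R\<^esub> A = \<one>\<^bsub>presented_group R\<^esub>"
  proof
    let ?B = "pres_rel R `` {rev (map (\<lambda>(x, s). (x, \<not> s)) w)}"
    show "?B \<otimes>\<^bsub>presented_group R\<^esub> A = \<one>\<^bsub>presented_group R\<^esub>"
      unfolding A pres_mult by (simp add: presented_group_def pres_class_eq pres_eq_inverse)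
    show "?B \<in> carrier (presented_group R)"
      by (simp add: presented_group_def quotientI)
  qed
  have one: "\<one>\<^bsub>presented_group R\<^esub> = pres_rel R `` {[]}" by (simp add: presented_group_def)
  show "\<one>\<^bsub>presented_group R\<^esub> \<otimes>\<^bsub>presented_group R\<^esub> A = A"
    unfolding A one pres_mult by simp
next
  fix A B assume "A \<in> carrier (presented_group R)" "B \<in> carrier (presented_group R)"
  then obtain v w where "A = pres_rel R `` {v}" "B = pres_rel R `` {w}"
    by (auto simp: presented_group_def elim!: quotientE)
  then show "A \<otimes>\<^bsub>presented_group R\<^esub> B \<in> carrier (presented_group R)"
    by (simp add: pres_mult) (simp add: presented_group_def quotientI)
next
  fix A B C assume "A \<in> carrier (presented_group R)" "B \<in> carrier (presented_group R)"
    "C \<in> carrier (presented_group R)"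
  then obtain u v w where "A = pres_rel R `` {u}" "B = pres_rel R `` {v}" "C = pres_rel R `` {w}"
    by (auto simp: presented_group_def elim!: quotientE)
  then show "A \<otimes>\<^bsub>presented_group R\<^esub> B \<otimes>\<^bsub>presented_group R\<^esub> C =
      A \<otimes>\<^bsub>presented_group R\<^esub> (B \<otimes>\<^bsub>presented_group R\<^esub> C)"
    by (simp add: pres_mult)
qed (simp add: presented_group_def quotientI)


section \<open>The semidihedral group of order \<open>8n\<close>\<close>

datatype sd_gen = Gen_a | Gen_b

definition sd_relations :: "nat \<Rightarrow> (sd_gen gword \<times> sd_gen gword) set" where
  "sd_relations n = (let a = (Gen_a, True); b = (Gen_b, True) in
     {(replicate (4 * n) a, []), ([b, b], []), ([b, a], replicate (2 * n - 1) a @ [b])})"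

definition semidihedral_group :: "nat \<Rightarrow> sd_gen gword set monoid" where
  "semidihedral_group n = presented_group (sd_relations n)"


section \<open>Commuting graphs and metric dimension\<close>

text \<open>Simple graphs are rendered as symmetric loop-free sets of arcs.\<close>

definition commuting_graph :: "('a, 'b) monoid_scheme \<Rightarrow> 'a pair_pre_digraph" where
  "commuting_graph G =
     \<lparr> pverts = carrier G,
       parcs = {(x, y). x \<in> carrier G \<and> y \<in> carrier G \<and> x \<noteq> y \<and> x \<otimes>\<^bsub>G\<^esub> y = y \<otimes>\<^bsub>G\<^esub> x} \<rparr>"

lemma pair_bidirected_digraph_commuting_graph: "pair_bidirected_digraph (commuting_graph G)"
  by unfold_locales (auto simp: commuting_graph_def symmetric_def sym_def)

text \<open>The least length of a walk, i.e. the least cost when every arc costs 1.\<close>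

definition graph_dist :: "'a pair_pre_digraph \<Rightarrow> 'a \<Rightarrow> 'a \<Rightarrow> ereal" where
  "graph_dist \<Gamma> u v = wf_digraph.\<mu> (with_proj \<Gamma>) (\<lambda>_. 1) u v"

definition resolves :: "'a pair_pre_digraph \<Rightarrow> 'a \<Rightarrow> 'a \<Rightarrow> 'a \<Rightarrow> bool" where
  "resolves \<Gamma> z u v \<longleftrightarrow> graph_dist \<Gamma> z u \<noteq> graph_dist \<Gamma> z v"

definition resolving_set :: "'a pair_pre_digraph \<Rightarrow> 'a set \<Rightarrow> bool" where
  "resolving_set \<Gamma> U \<longleftrightarrow> U \<subseteq> pverts \<Gamma> \<and>
     (\<forall>u\<in>pverts \<Gamma>. \<forall>v\<in>pverts \<Gamma>. u \<noteq> v \<longrightarrow> (\<exists>z\<in>U. resolves \<Gamma> z u v))"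

text \<open>Meaningful for graphs that have a finite resolving set, in particular for finite graphs.\<close>

definition metric_dimension :: "'a pair_pre_digraph \<Rightarrow> nat" where
  "metric_dimension \<Gamma> = (LEAST k. \<exists>U. finite U \<and> resolving_set \<Gamma> U \<and> card U = k)"

end

theory Submission
  imports Defs "HOL-Number_Theory.Cong"
begin

text \<open>
  The identity is adjacent to everything, so distances in a commuting graph are at most 2 and
  depend only on commutation. Hence two elements with the same centralizer are resolved only by
  themselves, and a resolving set omits at most one element from each class of elements with a
  common centralizer. If the centre is nontrivial, every class has at least two elements, and
  omitting exactly one from each still leaves, for every element \<open>w\<close>, some element with the
  centralizer of \<open>w\<close>; this suffices to resolve elements with different centralizers. So the metric
  dimension is \<open>|G|\<close> minus the number of centralizers. In \<open>SD\<^sub>8\<^sub>n\<close> the centralizers are the whole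
  group, \<open>\<langle>a\<rangle>\<close>, and one for each coset \<open>Z a\<^sup>i b\<close> of the centre \<open>Z\<close>.
\<close>

section \<open>Commuting graphs of groups with nontrivial centre\<close>

definition centralizer :: "('a, 'b) monoid_scheme \<Rightarrow> 'a \<Rightarrow> 'a set" where
  "centralizer G x = {y \<in> carrier G. x \<otimes>\<^bsub>G\<^esub> y = y \<otimes>\<^bsub>G\<^esub> x}"

lemma graph_dist_commuting_graph:
  fixes G (structure)
  assumes "group G" and x: "x \<in> carrier G" and y: "y \<in> carrier G"
  shows "graph_dist (commuting_graph G) x y =
    (if x = y then 0 else if y \<in> centralizer G x then 1 else 2)"
proof -
  interpret group G by fact
  interpret \<Gamma>: pair_bidirected_digraph "commuting_graph G"
    by (rule pair_bidirected_digraph_commuting_graph)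
  let ?\<mu> = "\<Gamma>.\<mu> (\<lambda>_. 1) x y"
  have cost: "\<Gamma>.awalk_cost (\<lambda>_. 1) p = real (length p)" for p :: "('a \<times> 'a) list"
    by (induction p) auto
  have \<mu>: "?\<mu> = (INF p\<in>{p. \<Gamma>.awalk x p y}. ereal (real (length p)))"
    unfolding \<Gamma>.\<mu>_def cost ..
  have le: "?\<mu> \<le> ereal (real k)" if "\<Gamma>.awalk x p y" "length p = k" for p k
    unfolding \<mu> using that by (auto intro: INF_lower2)
  have ge: "ereal (real k) \<le> ?\<mu>" if "\<And>p. \<Gamma>.awalk x p y \<Longrightarrow> k \<le> length p" for k
    unfolding \<mu> using that by (auto intro!: INF_greatest)
  have nonempty: "1 \<le> length p" if "\<Gamma>.awalk x p y" "x \<noteq> y" for p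
    using that by (cases p) (auto simp: \<Gamma>.awalk_simps)
  have arc: "(u, v) \<in> parcs (commuting_graph G) \<longleftrightarrow>
      u \<in> carrier G \<and> v \<in> centralizer G u \<and> u \<noteq> v" for u v
    by (auto simp: commuting_graph_def centralizer_def)
  have verts: "pverts (commuting_graph G) = carrier G"
    by (simp add: commuting_graph_def)
  consider "x = y" | "x \<noteq> y" "y \<in> centralizer G x" | "x \<noteq> y" "y \<notin> centralizer G x"
    by blast
  then have "?\<mu> = (if x = y then 0 else if y \<in> centralizer G x then 1 else 2)"
  proof cases
    case 1
    have "\<Gamma>.awalk x [] y" using 1 x by (simp add: \<Gamma>.awalk_simps verts)
    from le[OF this, of 0] ge[of 0] 1 show ?thesis
      by (simp add: zero_ereal_def antisym)
  next
    case 2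
    have "\<Gamma>.awalk x [(x, y)] y" using 2 x y by (simp add: \<Gamma>.awalk_simps verts arc)
    from le[OF this, of 1] ge[of 1] nonempty 2 show ?thesis
      by (simp add: one_ereal_def antisym)
  next
    case 3
    \<comment> \<open>Arcs join distinct vertices, so the detour through \<open>\<one>\<close> is a
      walk only if neither end is \<open>\<one>\<close>; non-commuting elements satisfy
      this.\<close>
    then have ne: "x \<noteq> \<one>" "y \<noteq> \<one>" using x y by (auto simp: centralizer_def)
    have "\<Gamma>.awalk x [(x, \<one>), (\<one>, y)] y"
      using ne x y by (simp add: \<Gamma>.awalk_simps verts arc centralizer_def)
    note up = le[OF this, of 2]
    have "2 \<le> length p" if p: "\<Gamma>.awalk x p y" for p
    proof (rule ccontr)
      assume "\<not> 2 \<le> length p"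
      then have "length p = 1" using nonempty[OF p] 3 by linarith
      then obtain e where "p = [e]" by (auto simp: length_Suc_conv)
      then show False using p 3 arc[of x y] by (cases e) (auto simp: \<Gamma>.awalk_simps)
    qed
    from ge[of 2, OF this] up 3 show ?thesis by (simp add: antisym)
  qed
  then show ?thesis by (simp add: graph_dist_def)
qed

section \<open>Elements with a common centralizer\<close>

lemma centralizer_sym:
  "x \<in> carrier G \<Longrightarrow> y \<in> centralizer G x \<Longrightarrow> x \<in> centralizer G y"
  by (simp add: centralizer_def)

text \<open>A central \<open>c\<close> moves past every \<open>y\<close>. For
  \<open>c \<noteq> \<one>\<close> this supplies a second element, \<open>x \<otimes> c\<close>, in
  the centralizer class of \<open>x\<close>.\<close>

lemma centralizer_mult_central:
  fixes G (structure)
  assumes "group G" and c: "centralizer G c = carrier G" "c \<in> carrier G"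
    and x: "x \<in> carrier G"
  shows "centralizer G (x \<otimes> c) = centralizer G x"
proof -
  interpret group G by fact
  have "x \<otimes> c \<otimes> y = y \<otimes> (x \<otimes> c) \<longleftrightarrow> x \<otimes> y = y \<otimes> x" if y: "y \<in> carrier G" for y
  proof -
    have "c \<otimes> y = y \<otimes> c" using c y by (auto simp: centralizer_def)
    then have "x \<otimes> c \<otimes> y = x \<otimes> y \<otimes> c" using c x y by (simp add: m_assoc)
    moreover have "y \<otimes> (x \<otimes> c) = y \<otimes> x \<otimes> c" using c x y by (simp add: m_assoc)
    ultimately show ?thesis using c x y by simp
  qed
  then show ?thesis by (auto simp: centralizer_def)
qed

theorem metric_dimension_commuting_graph:
  fixes G :: "('a, 'b) monoid_scheme" (structure)
  assumes "group G" and fin: "finite (carrier G)"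
    and c: "c \<in> carrier G" "c \<noteq> \<one>" "centralizer G c = carrier G"
  shows "metric_dimension (commuting_graph G) =
    card (carrier G) - card (centralizer G ` carrier G)"
proof -
  interpret group G by fact
  let ?C = "centralizer G ` carrier G"
  have verts: "pverts (commuting_graph G) = carrier G"
    by (simp add: commuting_graph_def)
  note dist = graph_dist_commuting_graph[OF \<open>group G\<close>]
  define \<rho> where "\<rho> S = (SOME x. x \<in> carrier G \<and> centralizer G x = S)" for S
  have \<rho>: "\<rho> S \<in> carrier G" "centralizer G (\<rho> S) = S" if "S \<in> ?C" for S
    using someI_ex[of "\<lambda>x. x \<in> carrier G \<and> centralizer G x = S"] that
    by (auto simp: \<rho>_def)
  define U where "U = carrier G - \<rho> ` ?C"
  have "inj_on \<rho> ?C" using \<rho>(2) by (metis inj_onI)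
  then have card_U: "card U = card (carrier G) - card ?C"
    unfolding U_def using fin \<rho>(1) by (subst card_Diff_subset) (auto simp: card_image)
  \<comment> \<open>If \<open>w\<close> is the omitted representative of its class,
    \<open>w \<otimes> c\<close> lies in the same class and differs from it, so it was kept.\<close>
  have twin: "\<exists>w'\<in>U. centralizer G w' = centralizer G w" if w: "w \<in> carrier G" for w
  proof (cases "w \<in> U")
    case False
    then have w_rep: "w = \<rho> (centralizer G w)" using w \<rho>(2) by (auto simp: U_def)
    have eq: "centralizer G (w \<otimes> c) = centralizer G w"
      by (rule centralizer_mult_central) (use c w in \<open>auto intro: group_axioms\<close>)
    have "w \<otimes> c \<noteq> w" using c w by simp
    then have "w \<otimes> c \<in> U" using w c \<rho>(2) eq w_rep by (auto simp: U_def)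
    with eq show ?thesis by blast
  qed blast
  have separate: "\<exists>z\<in>U. resolves (commuting_graph G) z u v"
    if u: "u \<in> carrier G" and v: "v \<in> carrier G"
      and w: "w \<in> centralizer G u" "w \<notin> centralizer G v" for u v w
  \<comment> \<open>Commuting is symmetric, so a kept \<open>z\<close> with the centralizer of
    \<open>w\<close> commutes with \<open>u\<close> but not with \<open>v\<close>. It may equal
    \<open>u\<close>, giving distances 0 and 2; otherwise they are 1 and 2.\<close>
  proof -
    have "w \<in> carrier G" using w(1) by (simp add: centralizer_def)
    from twin[OF this] obtain z where z: "z \<in> U" "centralizer G z = centralizer G w" ..
    have zc: "z \<in> carrier G" using z by (simp add: U_def)
    have "u \<in> centralizer G z" "v \<notin> centralizer G z"
      using z w u v centralizer_sym[of u G w] centralizer_sym[of w G v] \<open>w \<in> carrier G\<close> by auto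
    moreover from this have "z \<noteq> v" using zc by (auto simp: centralizer_def)
    ultimately have "resolves (commuting_graph G) z u v"
      using u v zc by (simp add: resolves_def dist)
    with z show ?thesis by blast
  qed
  have "resolving_set (commuting_graph G) U"
    unfolding resolving_set_def verts
  proof (intro conjI ballI impI)
    fix u v assume uv: "u \<in> carrier G" "v \<in> carrier G" "u \<noteq> v"
    have flip: "resolves \<Gamma> z v u \<longleftrightarrow> resolves \<Gamma> z u v" for z and \<Gamma> :: "'a pair_pre_digraph"
      by (auto simp: resolves_def)
    show "\<exists>z\<in>U. resolves (commuting_graph G) z u v"
    proof (cases "centralizer G u = centralizer G v")
      case False
      then show ?thesis using separate[of u v] separate[of v u] uv flip by blast
    next
      case True
      \<comment> \<open>Each class loses only one element, so \<open>u\<close> or \<open>v\<close>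
        is kept, and it resolves the pair through its distance 0 to itself.\<close>
      then have "u \<in> U \<or> v \<in> U" using uv \<rho>(2) by (auto simp: U_def)
      moreover have "resolves (commuting_graph G) u u v" "resolves (commuting_graph G) v u v"
        using uv by (auto simp: resolves_def dist)
      ultimately show ?thesis by blast
    qed
  qed (auto simp: U_def)
  moreover have "card (carrier G) - card ?C \<le> card V"
    if V: "resolving_set (commuting_graph G) V" for V
  proof -
    have sub: "V \<subseteq> carrier G" using V by (simp add: resolving_set_def verts)
    \<comment> \<open>A vertex of \<open>V\<close> is distinct from both elements outside
      \<open>V\<close>, so its distances to them are 1 or 2 according to commutation alone, and
      coincide when the centralizers do.\<close>
    have "inj_on (centralizer G) (carrier G - V)"
    proof (rule inj_onI, rule ccontr)
      fix u v assume u: "u \<in> carrier G - V" and v: "v \<in> carrier G - V"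
        and eq: "centralizer G u = centralizer G v" and "u \<noteq> v"
      then obtain z where z: "z \<in> V" "resolves (commuting_graph G) z u v"
        using V unfolding resolving_set_def verts by blast
      have "u \<in> centralizer G z \<longleftrightarrow> v \<in> centralizer G z"
        using eq u v z sub centralizer_sym[of z G] centralizer_sym[of u G z] centralizer_sym[of v G z]
        by auto
      moreover have "z \<noteq> u" "z \<noteq> v" "z \<in> carrier G" using z u v sub by auto
      ultimately show False using z(2) u v by (simp add: resolves_def dist split: if_splits)
    qed
    then have "card (carrier G - V) \<le> card ?C"
      by (metis card_image card_mono fin finite_imageI image_mono Diff_subset)
    then show ?thesis using sub fin by (simp add: card_Diff_subset finite_subset)
  qed
  moreover have "finite U" using fin by (simp add: U_def)
  ultimately show ?thesis
    unfolding metric_dimension_def card_U[symmetric] by (intro Least_equality) blast+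
qed


section \<open>Centralizers in the semidihedral group\<close>

text \<open>The centre of the semidihedral group is generated by \<open>a\<close> to this power.\<close>

definition sd_index :: "nat \<Rightarrow> nat" where
  "sd_index n = (if even n then 2 * n else n)"

text \<open>\<open>sd_index n\<close> is 4n / gcd(4n, 2n - 2). For even n the gcd is 2, since n - 1
  is coprime to 2n; for n = 2m + 1 it is 4, since 2n - 2 = 4m and m is coprime to n.\<close>

lemma sd_index_dvd_iff:
  fixes x :: int
  assumes "n \<ge> 2"
  shows "int (4 * n) dvd (2 * int n - 2) * x \<longleftrightarrow> int (sd_index n) dvd x"
proof (cases "even n")
  case True
  have "coprime (int n) (int n - 1)" "coprime 2 (int n - 1)"
    using True coprime_diff_one_left[of "int n"]
    by (simp_all add: coprime_commute)
  then have cop: "coprime (2 * int n) (int n - 1)" by simp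
  have "int (4 * n) dvd (2 * int n - 2) * x \<longleftrightarrow> 2 * (2 * int n) dvd 2 * ((int n - 1) * x)"
    by (simp add: algebra_simps)
  also have "\<dots> \<longleftrightarrow> 2 * int n dvd (int n - 1) * x"
    by (rule dvd_times_left_cancel_iff) simp
  also have "\<dots> \<longleftrightarrow> 2 * int n dvd x"
    using cop by (simp add: coprime_dvd_mult_right_iff)
  finally show ?thesis using True by (simp add: sd_index_def)
next
  case False
  then obtain m where m: "n = 2 * m + 1" by (auto elim: oddE)
  have cop: "coprime (int n) (int m)"
    unfolding m by (rule coprimeI) (metis dvd_add_right_iff dvd_mult of_nat_add of_nat_mult of_nat_1)
  have "int (4 * n) dvd (2 * int n - 2) * x \<longleftrightarrow> 4 * int n dvd 4 * (int m * x)"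
    by (simp add: m algebra_simps)
  also have "\<dots> \<longleftrightarrow> int n dvd int m * x"
    by (rule dvd_times_left_cancel_iff) simp
  also have "\<dots> \<longleftrightarrow> int n dvd x"
    using cop by (simp add: coprime_dvd_mult_right_iff)
  finally show ?thesis using False by (simp add: sd_index_def)
qed

text \<open>The two sides are the exponents of the products of \<open>a [^] i \<otimes> b\<close>
  and \<open>a [^] j \<otimes> b\<close> in either order. Their integer difference is (2n - 2)(j -
  i).\<close>

lemma sd_index_cong_iff:
  assumes "n \<ge> 2"
  shows "[i + (2 * n - 1) * j = j + (2 * n - 1) * i] (mod (4 * n)) \<longleftrightarrow> [i = j] (mod sd_index n)"
proof -
  have "[i + (2 * n - 1) * j = j + (2 * n - 1) * i] (mod (4 * n)) \<longleftrightarrow>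
      int (4 * n) dvd int (i + (2 * n - 1) * j) - int (j + (2 * n - 1) * i)"
    by (simp only: cong_int_iff[symmetric] cong_iff_dvd_diff)
  also have "int (i + (2 * n - 1) * j) - int (j + (2 * n - 1) * i) =
      (2 * int n - 2) * (int j - int i)"
  proof -
    have "int (2 * n - 1) = 2 * int n - 1" using assms by (simp add: of_nat_diff)
    then show ?thesis unfolding of_nat_add of_nat_mult by (simp add: algebra_simps)
  qed
  also have "int (4 * n) dvd \<dots> \<longleftrightarrow> [int j = int i] (mod int (sd_index n))"
    by (simp only: sd_index_dvd_iff[OF assms] cong_iff_dvd_diff)
  finally show ?thesis by (simp add: cong_int_iff cong_sym_eq)
qed

text \<open>Moving \<open>b\<close> past each factor \<open>a\<close> contributes \<open>r\<close>
  to the exponent. Stated for any group because it also serves to establish normal forms in the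
  presented group.\<close>

lemma (in group) twisted_pow:
  assumes [simp]: "a \<in> carrier G" "b \<in> carrier G" and b_a: "b \<otimes> a = a [^] (r::nat) \<otimes> b"
  shows "b \<otimes> a [^] (i::nat) = a [^] (r * i) \<otimes> b"
proof (induction i)
  case (Suc i)
  have "b \<otimes> a [^] Suc i = (b \<otimes> a [^] i) \<otimes> a" by (simp add: m_assoc)
  also have "\<dots> = a [^] (r * i) \<otimes> (b \<otimes> a)" by (simp add: Suc m_assoc)
  also have "\<dots> = a [^] (r * i) \<otimes> a [^] r \<otimes> b"
    by (simp add: b_a m_assoc)
  also have "\<dots> = a [^] (r * Suc i) \<otimes> b"
    by (simp add: nat_pow_mult add.commute)
  finally show ?case .
qed simp

text \<open>Collects what the centralizer computation needs from the presentation: every element has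
  a normal form, and \<open>pow_eq_iff\<close> with \<open>pow_neq\<close> makes the 8n normal forms
  distinct.\<close>

locale semidihedral = group G for G (structure) +
  fixes n :: nat and a b
  assumes n_ge_2: "n \<ge> 2"
    and a_closed [simp]: "a \<in> carrier G"
    and b_closed [simp]: "b \<in> carrier G"
    and carrier_eq: "carrier G = range (\<lambda>i::nat. a [^] i) \<union> range (\<lambda>i::nat. a [^] i \<otimes> b)"
    and pow_eq_iff: "a [^] i = a [^] j \<longleftrightarrow> [i = j] (mod (4 * n))"
    and pow_neq: "a [^] (i::nat) \<noteq> a [^] (j::nat) \<otimes> b"
    and b_square: "b \<otimes> b = \<one>"
    and b_a: "b \<otimes> a = a [^] (2 * n - 1) \<otimes> b"
begin

section \<open>Centralizers of the two kinds of elements\<close>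

lemma b_pow: "b \<otimes> a [^] (i::nat) = a [^] ((2 * n - 1) * i) \<otimes> b"
  by (rule twisted_pow) (simp_all add: b_a)

lemma pow_mem_centralizer_pow: "a [^] (j::nat) \<in> centralizer G (a [^] (i::nat))"
  by (simp add: centralizer_def nat_pow_mult add.commute)

lemma pow_b_mem_centralizer_pow_iff:
  "a [^] (j::nat) \<otimes> b \<in> centralizer G (a [^] (i::nat)) \<longleftrightarrow> sd_index n dvd i"
proof -
  have "a [^] i \<otimes> (a [^] j \<otimes> b) = a [^] (j + i) \<otimes> b"
    by (simp add: m_assoc[symmetric] nat_pow_mult add.commute)
  moreover have "a [^] j \<otimes> b \<otimes> a [^] i = a [^] (j + (2 * n - 1) * i) \<otimes> b"
    by (simp add: m_assoc b_pow) (simp add: m_assoc[symmetric] nat_pow_mult)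
  ultimately have "a [^] j \<otimes> b \<in> centralizer G (a [^] i) \<longleftrightarrow>
      [j + i = j + (2 * n - 1) * i] (mod (4 * n))"
    by (simp add: centralizer_def pow_eq_iff)
  \<comment> \<open>After cancelling \<open>j\<close> this is the criterion for the exponents
    \<open>i\<close> and 0.\<close>
  also have "\<dots> \<longleftrightarrow> [i = 0] (mod sd_index n)"
    using sd_index_cong_iff[OF n_ge_2, of i 0] by (simp only: cong_add_lcancel_nat) simp
  finally show ?thesis by (simp add: cong_0_iff)
qed

lemma pow_mem_centralizer_pow_b_iff:
  "a [^] (j::nat) \<in> centralizer G (a [^] (i::nat) \<otimes> b) \<longleftrightarrow> sd_index n dvd j"
  using pow_b_mem_centralizer_pow_iff[of i j] by (auto simp: centralizer_def)

lemma pow_b_mem_centralizer_pow_b_iff: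
  "a [^] (j::nat) \<otimes> b \<in> centralizer G (a [^] (i::nat) \<otimes> b) \<longleftrightarrow> [i = j] (mod sd_index n)"
proof -
  have "a [^] i \<otimes> b \<otimes> (a [^] j \<otimes> b) = a [^] (i + (2 * n - 1) * j)" for i j :: nat
  proof -
    have "a [^] i \<otimes> b \<otimes> (a [^] j \<otimes> b) = a [^] i \<otimes> (b \<otimes> a [^] j) \<otimes> b"
      by (simp add: m_assoc)
    also have "\<dots> = a [^] i \<otimes> a [^] ((2 * n - 1) * j) \<otimes> (b \<otimes> b)"
      unfolding b_pow by (simp add: m_assoc del: nat_pow_mult)
    finally show ?thesis by (simp add: b_square nat_pow_mult)
  qed
  then show ?thesis
    by (simp add: centralizer_def pow_eq_iff sd_index_cong_iff[OF n_ge_2] del: One_nat_def)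
qed

lemma centralizer_pow:
  "centralizer G (a [^] (i::nat)) =
    (if sd_index n dvd i then carrier G else range (\<lambda>j::nat. a [^] j))"
proof -
  have sub: "centralizer G x \<subseteq> carrier G" for x by (auto simp: centralizer_def)
  have "x \<in> centralizer G (a [^] i) \<longleftrightarrow> sd_index n dvd i \<or> x \<in> range (\<lambda>j::nat. a [^] j)"
    if x: "x \<in> carrier G" for x
  proof -
    consider j :: nat where "x = a [^] j" | j :: nat where "x = a [^] j \<otimes> b"
      using x unfolding carrier_eq by blast
    then show ?thesis
    proof cases
      case 1
      then show ?thesis by (simp add: pow_mem_centralizer_pow)
    next
      case 2
      then have "x \<notin> range (\<lambda>j::nat. a [^] j)" using pow_neq by (metis rangeE)
      with 2 show ?thesis by (simp only: pow_b_mem_centralizer_pow_iff simp_thms)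
    qed
  qed
  then show ?thesis using sub by auto
qed

text \<open>With Z the centre, the centralizer of \<open>a [^] i \<otimes> b\<close> is the union of
  Z and its coset containing that element, so it depends only on \<open>i\<close> modulo
  \<open>sd_index n\<close>.\<close>

lemma centralizer_pow_b_eq_iff:
  "centralizer G (a [^] (i::nat) \<otimes> b) = centralizer G (a [^] (j::nat) \<otimes> b) \<longleftrightarrow>
    [i = j] (mod sd_index n)"
proof
  assume "centralizer G (a [^] i \<otimes> b) = centralizer G (a [^] j \<otimes> b)"
  then show "[i = j] (mod sd_index n)"
    using pow_b_mem_centralizer_pow_b_iff[of j i] pow_b_mem_centralizer_pow_b_iff[of j j] by simp
next
  assume ij: "[i = j] (mod sd_index n)"
  have sub: "centralizer G x \<subseteq> carrier G" for x by (auto simp: centralizer_def)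
  have "x \<in> centralizer G (a [^] i \<otimes> b) \<longleftrightarrow> x \<in> centralizer G (a [^] j \<otimes> b)"
    if "x \<in> carrier G" for x
    using that ij unfolding carrier_eq
    by (auto simp: pow_mem_centralizer_pow_b_iff pow_b_mem_centralizer_pow_b_iff cong_def)
  with sub show "centralizer G (a [^] i \<otimes> b) = centralizer G (a [^] j \<otimes> b)" by blast
qed

text \<open>Powers of \<open>a\<close> contribute the whole group and the cyclic subgroup, told
  apart by \<open>b\<close>. The elements \<open>a [^] i \<otimes> b\<close> contribute one
  centralizer per residue; none of these contains \<open>a\<close>, because
  \<open>sd_index n\<close> exceeds 1.\<close>

lemma card_centralizers: "card (centralizer G ` carrier G) = sd_index n + 2"
proof -
  let ?A = "range (\<lambda>j::nat. a [^] j)" and ?f = "\<lambda>i::nat. centralizer G (a [^] i \<otimes> b)"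
  let ?h = "sd_index n"
  have h: "?h \<ge> 2" using n_ge_2 by (simp add: sd_index_def)
  have not_dvd: "\<not> ?h dvd 1" using h by auto
  have b_notin: "b \<notin> ?A" using pow_neq[of _ 0] by force
  have a_notin: "a \<notin> ?f i" for i
    using pow_mem_centralizer_pow_b_iff[of 1 i] not_dvd by simp
  have a_in: "a \<in> ?A" by (rule range_eqI[where x = 1]) simp
  have range_f: "range ?f = ?f ` {..<?h}"
  proof -
    have "?f i = ?f (i mod ?h)" for i by (simp add: centralizer_pow_b_eq_iff)
    moreover have "i mod ?h \<in> {..<?h}" for i using h by simp
    ultimately show ?thesis by blast
  qed
  have "(\<lambda>i::nat. centralizer G (a [^] i)) ` UNIV = {carrier G, ?A}"
  proof -
    have "centralizer G (a [^] (0::nat)) = carrier G" "centralizer G (a [^] (1::nat)) = ?A"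
      using not_dvd by (simp_all only: centralizer_pow) auto
    moreover have "centralizer G (a [^] i) \<in> {carrier G, ?A}" for i :: nat
      by (simp add: centralizer_pow)
    ultimately show ?thesis by blast
  qed
  then have "centralizer G ` carrier G = {carrier G, ?A} \<union> ?f ` {..<?h}"
    unfolding range_f[symmetric] carrier_eq image_Un image_image by simp
  moreover have "{carrier G, ?A} \<inter> ?f ` {..<?h} = {}"
    using a_notin a_in a_closed by blast
  moreover have "carrier G \<noteq> ?A" using b_notin b_closed by blast
  moreover have "inj_on ?f {..<?h}"
    by (rule inj_onI) (auto simp: centralizer_pow_b_eq_iff cong_def)
  ultimately show ?thesis
    by (simp add: card_Un_disjoint card_image)
qed

section \<open>Order of the group and metric dimension\<close>

lemma carrier_eq_finite:
  "carrier G = (\<lambda>i. a [^] i) ` {..<4 * n} \<union> (\<lambda>i. a [^] i \<otimes> b) ` {..<4 * n}"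
proof -
  have "range f = f ` {..<4 * n}" if "\<And>i. f i = f (i mod (4 * n))" for f :: "nat \<Rightarrow> 'a"
  proof -
    have "i mod (4 * n) \<in> {..<4 * n}" for i using n_ge_2 by simp
    with that show ?thesis by blast
  qed
  moreover have "a [^] i = a [^] (i mod (4 * n))" for i :: nat
    by (simp add: pow_eq_iff)
  ultimately show ?thesis unfolding carrier_eq by metis
qed

lemma card_carrier: "card (carrier G) = 8 * n"
proof -
  have inj: "inj_on (\<lambda>i::nat. a [^] i) {..<4 * n}"
    by (rule inj_onI) (simp add: pow_eq_iff cong_def)
  then have "inj_on (\<lambda>i::nat. a [^] i \<otimes> b) {..<4 * n}"
    by (simp add: inj_on_def)
  with inj show ?thesis unfolding carrier_eq_finite
    using pow_neq by (subst card_Un_disjoint) (auto simp: card_image)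
qed

lemma metric_dimension_semidihedral:
  "metric_dimension (commuting_graph G) = 8 * n - (sd_index n + 2)"
proof -
  let ?c = "a [^] sd_index n"
  \<comment> \<open>As 0 < \<open>sd_index n\<close> < 4n, the central power \<open>?c\<close> is
    not the identity.\<close>
  have "\<not> [sd_index n = 0] (mod (4 * n))"
    using n_ge_2 by (auto simp: cong_def sd_index_def)
  then have "?c \<noteq> \<one>" using pow_eq_iff[of "sd_index n" 0] by simp
  moreover have "finite (carrier G)" unfolding carrier_eq_finite by simp
  ultimately show ?thesis
    using metric_dimension_commuting_graph[of G ?c]
    by (simp add: centralizer_pow card_carrier card_centralizers group_axioms)
qed

end


section \<open>Normal forms in the presented group\<close>

text \<open>Left multiplication by a letter on the normal forms \<open>a\<^sup>i b\<^sup>t\<close>, encoded as \<open>(i, t)\<close>.\<close>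

definition sd_act :: "nat \<Rightarrow> sd_gen \<times> bool \<Rightarrow> nat \<times> bool \<Rightarrow> nat \<times> bool" where
  "sd_act n l p = (case fst l of
     Gen_a \<Rightarrow> ((fst p + (if snd l then 1 else 4 * n - 1)) mod (4 * n), snd p)
   | Gen_b \<Rightarrow> ((2 * n - 1) * fst p mod (4 * n), \<not> snd p))"

section \<open>The action of words on normal forms\<close>

lemma sd_act_less: "n > 0 \<Longrightarrow> fst (sd_act n l p) < 4 * n"
  by (auto simp: sd_act_def split: sd_gen.split)

lemma foldr_sd_act_less:
  "n > 0 \<Longrightarrow> fst p < 4 * n \<Longrightarrow> fst (foldr (sd_act n) w p) < 4 * n"
  by (induction w) (auto simp: sd_act_less)

lemma foldr_sd_act_replicate:
  "fst p < 4 * n \<Longrightarrow>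
    foldr (sd_act n) (replicate k (Gen_a, True)) p = ((fst p + k) mod (4 * n), snd p)"
  by (induction k) (auto simp: sd_act_def mod_simps)

text \<open>(2n - 1)^2 = 4n(n - 1) + 1, so multiplication by 2n - 1 is an involution modulo 4n.
  Hence \<open>Gen_b\<close> acts as an involution, and one rule serves it and its formal
  inverse.\<close>

lemma sd_square_cong:
  fixes n i :: nat
  assumes "n > 0"
  shows "(2 * n - 1) * ((2 * n - 1) * i) mod (4 * n) = i mod (4 * n)"
proof -
  obtain m where m: "n = Suc m" using assms gr0_conv_Suc by blast
  have "(2 * n - 1) * ((2 * n - 1) * i) = i + 4 * n * (m * i)"
    by (simp add: m algebra_simps)
  then show ?thesis by simp
qed

text \<open>Adding N - 1 undoes adding 1 modulo N, so \<open>Gen_a\<close> and its formal inverse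
  act as mutually inverse maps on reduced exponents.\<close>

lemma mod_shift_cancel:
  fixes i N :: nat
  assumes "i < N"
  shows "((i + (N - 1)) mod N + 1) mod N = i" "((i + 1) mod N + (N - 1)) mod N = i"
  using assms by (simp_all only: mod_add_left_eq) simp_all

text \<open>Free cancellation and the three relations hold for the action, so a word acts through
  the element it represents. The bound on \<open>p\<close> matters because the action reduces
  exponents, while the empty word leaves them as they are.\<close>

lemma foldr_sd_act_pres_eq:
  assumes "pres_eq (sd_relations n) v w" and n: "n > 0"
  shows "fst p < 4 * n \<Longrightarrow> foldr (sd_act n) v p = foldr (sd_act n) w p"
  using assms(1)
proof (induction arbitrary: p rule: pres_eq.induct)
  case (cancel u x s v)
  let ?q = "foldr (sd_act n) v p"
  have "fst ?q < 4 * n" using cancel n by (simp add: foldr_sd_act_less)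
  then have "sd_act n (x, s) (sd_act n (x, \<not> s) ?q) = ?q"
    using sd_square_cong[OF n, of "fst ?q"] mod_shift_cancel[of "fst ?q" "4 * n"]
    by (simp add: sd_act_def mod_simps prod_eq_iff del: One_nat_def split: sd_gen.split)
  then show ?case by simp
next
  case (rel l r u v)
  let ?q = "foldr (sd_act n) v p"
  have q: "fst ?q < 4 * n" using rel n by (simp add: foldr_sd_act_less)
  define e where "e = 2 * n - 1"
  have "foldr (sd_act n) l ?q = foldr (sd_act n) r ?q"
    using rel(1) q n sd_square_cong[OF n, of "fst ?q"]
    by (auto simp: e_def[symmetric] sd_relations_def Let_def foldr_sd_act_replicate sd_act_def mod_simps
          prod_eq_iff distrib_left add.commute simp del: foldr_replicate One_nat_def)
  then show ?case by simp
qed auto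

lemma semidihedral_semidihedral_group:
  assumes n: "n \<ge> 2"
  shows "semidihedral (semidihedral_group n) n
    (pres_rel (sd_relations n) `` {[(Gen_a, True)]}) (pres_rel (sd_relations n) `` {[(Gen_b, True)]})"
proof -
  let ?R = "sd_relations n"
  define c where "c w = pres_rel ?R `` {w}" for w
  define G where "G = semidihedral_group n"
  define a b where "a = c [(Gen_a, True)]" and "b = c [(Gen_b, True)]"
  interpret group G
    unfolding G_def semidihedral_group_def by (rule group_presented_group)
  have c_closed: "c w \<in> carrier G" for w
    by (simp add: c_def G_def semidihedral_group_def presented_group_def quotientI)
  have c_append: "c (v @ w) = c v \<otimes>\<^bsub>G\<^esub> c w" for v w
    unfolding c_def G_def semidihedral_group_def by (rule pres_mult[symmetric])
  have c_Nil: "c [] = \<one>\<^bsub>G\<^esub>"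
    by (simp add: c_def G_def semidihedral_group_def presented_group_def)
  have c_eq: "c v = c w \<longleftrightarrow> pres_eq ?R v w" for v w
    unfolding c_def by (rule pres_class_eq)
  have c_rel: "c l = c r" if "(l, r) \<in> ?R" for l r
    using pres_eq.rel[OF that, of "[]" "[]"] by (simp add: c_eq)
  have closed [simp]: "a \<in> carrier G" "b \<in> carrier G"
    by (simp_all add: a_def b_def c_closed)
  have c_pow: "c (replicate k (Gen_a, True)) = a [^]\<^bsub>G\<^esub> k" for k
  proof (induction k)
    case (Suc k)
    have "c (replicate (Suc k) (Gen_a, True)) = c (replicate k (Gen_a, True)) \<otimes>\<^bsub>G\<^esub> a"
      unfolding a_def c_append[symmetric] by (simp add: replicate_append_same)
    then show ?case by (simp add: Suc)
  qed (simp add: c_Nil)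
  have a_pow: "a [^]\<^bsub>G\<^esub> (4 * n) = \<one>\<^bsub>G\<^esub>"
    using c_rel[of "replicate (4 * n) (Gen_a, True)" "[]"]
    by (simp add: c_pow c_Nil sd_relations_def Let_def)
  have bb: "b \<otimes>\<^bsub>G\<^esub> b = \<one>\<^bsub>G\<^esub>"
    using c_rel[of "[(Gen_b, True), (Gen_b, True)]" "[]"] c_append[of "[(Gen_b, True)]" "[(Gen_b, True)]"]
    by (simp add: b_def c_Nil sd_relations_def Let_def)
  have ba: "b \<otimes>\<^bsub>G\<^esub> a = a [^]\<^bsub>G\<^esub> (2 * n - 1) \<otimes>\<^bsub>G\<^esub> b"
    using c_rel[of "[(Gen_b, True), (Gen_a, True)]" "replicate (2 * n - 1) (Gen_a, True) @ [(Gen_b, True)]"]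
      c_append[of "[(Gen_b, True)]" "[(Gen_a, True)]"]
    by (simp add: a_def b_def c_append sd_relations_def Let_def c_pow[unfolded a_def])
  have letter_inv: "c [(x, False)] \<otimes>\<^bsub>G\<^esub> c [(x, True)] = \<one>\<^bsub>G\<^esub>" for x
    using pres_eq.cancel[of ?R "[]" x False "[]"]
    by (simp add: c_append[symmetric] c_Nil[symmetric] c_eq)
  have b_inv: "c [(Gen_b, False)] = b"
    using letter_inv[of Gen_b] bb right_cancel[of b "c [(Gen_b, False)]" b]
    by (simp add: b_def c_closed)
  have "a [^]\<^bsub>G\<^esub> (4 * n - 1) \<otimes>\<^bsub>G\<^esub> a = a [^]\<^bsub>G\<^esub> Suc (4 * n - 1)"
    by simp
  also have "\<dots> = \<one>\<^bsub>G\<^esub>" using a_pow n by (simp del: nat_pow_Suc)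
  finally have a_inv: "c [(Gen_a, False)] = a [^]\<^bsub>G\<^esub> (4 * n - 1)"
    using letter_inv[of Gen_a] right_cancel[of a "c [(Gen_a, False)]" "a [^]\<^bsub>G\<^esub> (4 * n - 1)"]
    by (simp add: a_def[symmetric] c_closed)
  have b_pow: "b \<otimes>\<^bsub>G\<^esub> a [^]\<^bsub>G\<^esub> i = a [^]\<^bsub>G\<^esub> ((2 * n - 1) * i) \<otimes>\<^bsub>G\<^esub> b" for i :: nat
    by (rule twisted_pow) (simp_all add: ba)
  let ?S = "range (\<lambda>i::nat. a [^]\<^bsub>G\<^esub> i) \<union> range (\<lambda>i::nat. a [^]\<^bsub>G\<^esub> i \<otimes>\<^bsub>G\<^esub> b)"
  \<comment> \<open>Prepending a letter preserves normal forms; inverse letters are first replaced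
    using \<open>a_inv\<close> and \<open>b_inv\<close>.\<close>
  have mem: "c w \<in> ?S" for w
  proof (induction w)
    case Nil
    then show ?case by (metis c_Nil nat_pow_0 rangeI UnI1)
  next
    case (Cons l w)
    have pow_S: "a [^]\<^bsub>G\<^esub> k \<otimes>\<^bsub>G\<^esub> x \<in> ?S" if "x \<in> ?S" for x and k :: nat
      using that by (auto simp: m_assoc[symmetric] nat_pow_mult)
    have b_S: "b \<otimes>\<^bsub>G\<^esub> x \<in> ?S" if "x \<in> ?S" for x
      using that
      by (auto simp: m_assoc[symmetric] b_pow) (auto simp: m_assoc bb)
    have "c (l # w) = c [l] \<otimes>\<^bsub>G\<^esub> c w" using c_append[of "[l]" w] by simp
    moreover obtain x s where "l = (x, s)" by force
    ultimately show ?case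
      using Cons pow_S[of "c w" 1] pow_S[of "c w" "4 * n - 1"] b_S[of "c w"]
      by (cases x; cases s) (simp_all add: a_def[symmetric] b_def[symmetric] a_inv b_inv)
  qed
  \<comment> \<open>Acting on \<open>(0, False)\<close>, the code of the identity, gives an
    invariant of the class, which separates the normal forms.\<close>
  have nf: "foldr (sd_act n) v (0, False) = foldr (sd_act n) w (0, False)" if "c v = c w" for v w
    using foldr_sd_act_pres_eq[of n v w "(0, False)"] that n by (simp add: c_eq)
  have pow_eq: "a [^]\<^bsub>G\<^esub> i = a [^]\<^bsub>G\<^esub> j \<longleftrightarrow> [i = j] (mod (4 * n))" for i j :: nat
  proof
    assume "a [^]\<^bsub>G\<^esub> i = a [^]\<^bsub>G\<^esub> j"
    then show "[i = j] (mod (4 * n))"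
      using nf[of "replicate i (Gen_a, True)" "replicate j (Gen_a, True)"] n
      by (simp del: foldr_replicate add: c_pow foldr_sd_act_replicate cong_def)
  next
    have "a [^]\<^bsub>G\<^esub> k = a [^]\<^bsub>G\<^esub> (k mod (4 * n))" for k
    proof -
      have "a [^]\<^bsub>G\<^esub> k = a [^]\<^bsub>G\<^esub> (4 * n * (k div (4 * n)) + k mod (4 * n))" by simp
      also have "\<dots> = a [^]\<^bsub>G\<^esub> (k mod (4 * n))"
        by (simp only: nat_pow_mult[symmetric] nat_pow_pow[symmetric] closed a_pow nat_pow_one)
          simp
      finally show ?thesis .
    qed
    moreover assume "[i = j] (mod (4 * n))"
    ultimately show "a [^]\<^bsub>G\<^esub> i = a [^]\<^bsub>G\<^esub> j" by (metis cong_def)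
  qed
  have pow_neq: "a [^]\<^bsub>G\<^esub> i \<noteq> a [^]\<^bsub>G\<^esub> j \<otimes>\<^bsub>G\<^esub> b" for i j :: nat
  proof
    assume "a [^]\<^bsub>G\<^esub> i = a [^]\<^bsub>G\<^esub> j \<otimes>\<^bsub>G\<^esub> b"
    then have "c (replicate i (Gen_a, True)) = c (replicate j (Gen_a, True) @ [(Gen_b, True)])"
      by (simp add: c_append c_pow b_def)
    \<comment> \<open>Only \<open>Gen_b\<close> flips the flag: the first word leaves it
      \<open>False\<close>, the second makes it \<open>True\<close>.\<close>
    from nf[OF this] n show False
      by (simp del: foldr_replicate add: foldr_sd_act_replicate sd_act_def)
  qed
  have "carrier G = ?S"
  proof
    show "carrier G \<subseteq> ?S"
    proof
      fix x assume "x \<in> carrier G"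
      then obtain w where "x = c w"
        by (auto simp: G_def semidihedral_group_def presented_group_def c_def elim: quotientE)
      with mem show "x \<in> ?S" by simp
    qed
  qed auto
  then have "semidihedral G n a b"
    by unfold_locales (use n closed bb ba pow_eq pow_neq in \<open>auto simp only:\<close>)
  then show ?thesis by (simp add: G_def a_def b_def c_def)
qed

theorem proposition4p26:
  fixes n :: nat
  assumes "n \<ge> 2"
  shows "metric_dimension (commuting_graph (semidihedral_group n)) =
    (if even n then 6 * n - 2 else 7 * n - 2)"
  using semidihedral.metric_dimension_semidihedral[OF semidihedral_semidihedral_group[OF assms]]
  by (simp add: sd_index_def)

end
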